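(* Let $G$ be a finite simple connected graph of odd order, let $f:V(G)\rightarrow \mathbb{Z}^+$ be an even integer-valued function with $f(v)\geq 4$ for all $v\in V(G)$, and let $H_f(v)=\{1,3,\ldots,f(v)-1,f(v)\}$ for $v\in V(G)$. Suppose that $d_G(v)\geq f(v)-1$ for all $v\in V(G)$. If $$o(G-S)\leq f(S)\qquad\text{for all } \emptyset\neq S\subseteq V(G),$$ then $G$ contains an $H_f$-factor.
   Context: For $S\subseteq V(G)$, $f(S)=\sum_{x\in S}f(x)$, and $o(G-S)$ denotes the number of components of odd order of $G-S$. For a set function $H$ assigning to each vertex $v$ a set $H(v)$ of integers, an $H$-factor of $G$ is a spanning subgraph $F$ of $G$ with $d_F(v)\in H(v)$ for every $v\in V(G)$. *)

theory Defs
  imports "Graph_Theory.Digraph_Component"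
begin

text \<open>
  A finite simple undirected graph is a symmetric digraph \<open>G\<close> satisfying the library locale
  predicate \<open>graph G\<close>: an edge \<open>uv\<close> is the pair of arcs from \<open>u\<close> to \<open>v\<close> and from \<open>v\<close> to \<open>u\<close>, so
  the degree of a vertex is its out-degree, and the connected components are the strongly
  connected components.
\<close>

definition vdegree :: "('a,'b) pre_digraph \<Rightarrow> 'a \<Rightarrow> nat" where
  "vdegree G v = out_degree G v"

definition delete_verts :: "('a,'b) pre_digraph \<Rightarrow> 'a set \<Rightarrow> ('a,'b) pre_digraph" where
  "delete_verts G S = G \<restriction> (verts G - S)"

definition odd_components :: "('a,'b) pre_digraph \<Rightarrow> ('a,'b) pre_digraph set" where
  "odd_components G = {C \<in> pre_digraph.sccs G. odd (card (verts C))}"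

definition num_odd_components :: "('a,'b) pre_digraph \<Rightarrow> nat" where
  "num_odd_components G = card (odd_components G)"

text \<open>The conjunct \<open>graph F\<close> makes the arc set of \<open>F\<close> symmetric, i.e. \<open>F\<close> an undirected subgraph.\<close>

definition H_factor ::
  "('a,'b) pre_digraph \<Rightarrow> ('a \<Rightarrow> int set) \<Rightarrow> ('a,'b) pre_digraph \<Rightarrow> bool" where
  "H_factor G H F \<longleftrightarrow>
     spanning F G \<and> graph F \<and> (\<forall>v\<in>verts G. int (vdegree F v) \<in> H v)"

text \<open>For even \<open>f v\<close> this is \<open>{1, 3, \<dots>, f v - 1, f v}\<close>.\<close>

definition H_f :: "('a \<Rightarrow> int) \<Rightarrow> 'a \<Rightarrow> int set" where
  "H_f f v = {k. odd k \<and> 1 \<le> k \<and> k \<le> f v - 1} \<union> {f v}"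

end

theory Submission
  imports Defs
begin

text \<open>
  Call a spanning subgraph \<open>F\<close> feasible if no degree exceeds \<open>f\<close>, a vertex full if its degree is
  \<open>f v\<close>, and bad if its degree is even and below \<open>f v\<close>; an \<open>H\<^sub>f\<close>-factor is a feasible subgraph without
  bad vertices. Choose \<open>F\<close> with as few bad vertices as possible. Let \<open>D\<close> be the set of vertices that are
  bad in some optimal subgraph and \<open>A\<close> the set of neighbours of \<open>D\<close> outside \<open>D\<close>. Exchanging along trails
  of the symmetric difference of two optimal subgraphs moves the bad vertices of the first to those of
  the second without changing its full vertices. Hence vertices of \<open>D\<close> are never full and vertices of
  \<open>A\<close> are always full. Since \<open>D\<close> has no full vertices, badness can be moved along every edge inside \<open>D\<close>
  by toggling it, so a component of \<open>D\<close> contains at most one bad vertex, and then \<open>F\<close> has no edge leaving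
  the component; otherwise \<open>F\<close> has at most one such edge. As \<open>F\<close>-edges at \<open>A\<close> lead to \<open>D\<close>, the components
  of \<open>D\<close>, all of odd order, outnumber \<open>f(A)\<close> by at least the number of bad vertices. For nonempty \<open>A\<close> the
  hypothesis leaves no bad vertex; for empty \<open>A\<close> the degree condition allows adding edges to \<open>F\<close>
  indefinitely while a bad vertex remains.
\<close>

section \<open>Degrees in finite edge sets and exchange along trails\<close>

definition deg :: "'a set set \<Rightarrow> 'a \<Rightarrow> nat" where
  "deg F v = card {e \<in> F. v \<in> e}"

text \<open>A unit step of a jump system. If \<open>d a = d' a\<close> the value is a default
  without meaning, so the steps come with an inequality at the vertex that is moved.\<close>

definition toward :: "('a \<Rightarrow> nat) \<Rightarrow> ('a \<Rightarrow> nat) \<Rightarrow> 'a \<Rightarrow> 'a \<Rightarrow> nat" where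
  "toward d d' a = d(a := if d a < d' a then Suc (d a) else d a - 1)"

definition toggle :: "'b \<Rightarrow> 'b set \<Rightarrow> 'b set" where
  "toggle e F = (if e \<in> F then F - {e} else insert e F)"

lemma deg_insert:
  assumes "finite F" "e \<notin> F"
  shows "deg (insert e F) v = (if v \<in> e then Suc (deg F v) else deg F v)"
proof (cases "v \<in> e")
  case True
  then have "{x \<in> insert e F. v \<in> x} = insert e {x \<in> F. v \<in> x}" by auto
  then show ?thesis using assms True by (simp add: deg_def)
next
  case False
  then have "{x \<in> insert e F. v \<in> x} = {x \<in> F. v \<in> x}" by auto
  then show ?thesis using False by (simp add: deg_def)
qed

lemma deg_remove:
  assumes "finite F" "e \<in> F"
  shows "deg F v = (if v \<in> e then Suc (deg (F - {e}) v) else deg (F - {e}) v)"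
  using deg_insert[of "F - {e}" e v] assms by (simp add: insert_absorb)

lemma deg_less_obtain_edge:
  assumes "finite F" "finite F'" "deg F v < deg F' v"
  obtains e where "e \<in> F'" "e \<notin> F" "v \<in> e"
proof -
  have "\<not> {e \<in> F'. v \<in> e} \<subseteq> {e \<in> F. v \<in> e}"
    using assms card_mono[of "{e \<in> F. v \<in> e}" "{e \<in> F'. v \<in> e}"] by (auto simp: deg_def)
  then show thesis using that by blast
qed

lemma doubleton_other:
  assumes "card e = 2" "a \<in> e"
  obtains x where "e = {a, x}" "x \<noteq> a"
  using assms by (auto simp: card_2_iff)

text \<open>Degree sequences of the spanning subgraphs form a jump system: the step at \<open>a\<close> can be
  completed by a second step, found along a trail in the symmetric difference.\<close>
lemma exchange_step:
  assumes "finite F" "finite F'" "\<And>e. e \<in> F \<union> F' \<Longrightarrow> card e = 2" "deg F a \<noteq> deg F' a"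
  shows "\<exists>F2 c. F2 \<subseteq> F \<union> F' \<and> toward (deg F) (deg F') a c \<noteq> deg F' c \<and>
    deg F2 = toward (toward (deg F) (deg F') a) (deg F') c"
  using assms
proof (induction "card (F - F' \<union> (F' - F))" arbitrary: F a rule: less_induct)
  case less
  have fin: "finite (F - F' \<union> (F' - F))" using less.prems by auto
  show ?case
  proof (cases "deg F' a < deg F a")
    case True
    obtain e where e: "e \<in> F" "e \<notin> F'" "a \<in> e"
      using deg_less_obtain_edge[OF less.prems(2,1) True] by blast
    obtain x where x: "e = {a, x}" "x \<noteq> a" using doubleton_other[of e a] e less.prems(3) by blast
    define F1 where "F1 = F - {e}"
    have d: "deg F v = (if v \<in> e then Suc (deg F1 v) else deg F1 v)" for v
      unfolding F1_def by (rule deg_remove[OF less.prems(1) e(1)])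
    have "deg F1 v = (if v \<in> e then deg F v - 1 else deg F v)" for v
      using d[of v] by simp
    then have d1: "deg F1 = (deg F)(a := deg F a - 1, x := deg F x - 1)"
      using x by (auto simp: fun_eq_iff)
    have pos: "0 < deg F x" using d[of x] x by simp
    show ?thesis
    proof (cases "deg F' x < deg F x")
      case xl: True
      have "deg F1 = toward (toward (deg F) (deg F') a) (deg F') x"
        using True xl x by (auto simp: d1 toward_def fun_eq_iff)
      moreover have "toward (deg F) (deg F') a x \<noteq> deg F' x" using xl x by (simp add: toward_def)
      moreover have "F1 \<subseteq> F \<union> F'" by (auto simp: F1_def)
      ultimately show ?thesis by blast
    next
      case False
      \<comment> \<open>Removing \<open>e\<close> took \<open>x\<close> further from its target, so
        the trail continues at \<open>x\<close>. With \<open>e\<close> gone the symmetric difference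
        is smaller, and the first step of the induction hypothesis restores \<open>x\<close>; its
        effect is therefore the step at \<open>a\<close> from \<open>F\<close>.\<close>
      have lt: "card (F1 - F' \<union> (F' - F1)) < card (F - F' \<union> (F' - F))"
        by (rule psubset_card_mono[OF fin]) (use e in \<open>auto simp: F1_def\<close>)
      have ne: "deg F1 x < deg F' x" using False pos by (simp add: d1)
      obtain F2 c where F2: "F2 \<subseteq> F1 \<union> F'" "toward (deg F1) (deg F') x c \<noteq> deg F' c"
        "deg F2 = toward (toward (deg F1) (deg F') x) (deg F') c"
        using less.hyps[OF lt, of x] ne less.prems by (auto simp: F1_def)
      have "toward (deg F1) (deg F') x = toward (deg F) (deg F') a"
        using ne True x pos by (auto simp: toward_def d1 fun_eq_iff)
      moreover have "F2 \<subseteq> F \<union> F'" using F2(1) by (auto simp: F1_def)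
      ultimately show ?thesis using F2 by auto
    qed
  next
    case False
    then have al: "deg F a < deg F' a" using less.prems(4) by simp
    obtain e where e: "e \<in> F'" "e \<notin> F" "a \<in> e"
      using deg_less_obtain_edge[OF less.prems(1,2) al] by blast
    obtain x where x: "e = {a, x}" "x \<noteq> a" using doubleton_other[of e a] e less.prems(3) by blast
    define F1 where "F1 = insert e F"
    have d: "deg F1 v = (if v \<in> e then Suc (deg F v) else deg F v)" for v
      unfolding F1_def by (rule deg_insert[OF less.prems(1) e(2)])
    have d1: "deg F1 = (deg F)(a := Suc (deg F a), x := Suc (deg F x))"
      using d x by (auto simp: fun_eq_iff)
    show ?thesis
    proof (cases "deg F x < deg F' x")
      case xl: True
      have "deg F1 = toward (toward (deg F) (deg F') a) (deg F') x"
        using al xl x by (auto simp: d1 toward_def fun_eq_iff)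
      moreover have "toward (deg F) (deg F') a x \<noteq> deg F' x" using xl x by (simp add: toward_def)
      moreover have "F1 \<subseteq> F \<union> F'" using e by (auto simp: F1_def)
      ultimately show ?thesis by blast
    next
      case xl: False
      have lt: "card (F1 - F' \<union> (F' - F1)) < card (F - F' \<union> (F' - F))"
        by (rule psubset_card_mono[OF fin]) (use e in \<open>auto simp: F1_def\<close>)
      have ne: "deg F' x < deg F1 x" using xl by (simp add: d1)
      obtain F2 c where F2: "F2 \<subseteq> F1 \<union> F'" "toward (deg F1) (deg F') x c \<noteq> deg F' c"
        "deg F2 = toward (toward (deg F1) (deg F') x) (deg F') c"
        using less.hyps[OF lt, of x] ne less.prems e by (auto simp: F1_def)
      have "toward (deg F1) (deg F') x = toward (deg F) (deg F') a"
        using ne al x by (auto simp: toward_def d1 fun_eq_iff)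
      moreover have "F2 \<subseteq> F \<union> F'" using F2(1) e by (auto simp: F1_def)
      ultimately show ?thesis using F2 by auto
    qed
  qed
qed

lemma card_swap:
  assumes "finite B" "x \<in> B" "y \<notin> B"
  shows "card (insert y (B - {x})) = card B"
  using assms card_Suc_Diff1[of B x] by simp

lemma set_eq_offI:
  assumes "\<And>v. v \<noteq> y \<Longrightarrow> v \<noteq> c \<Longrightarrow> v \<in> S \<longleftrightarrow> v \<in> T"
    and "y \<in> S \<longleftrightarrow> y \<in> T" "c \<in> S \<longleftrightarrow> c \<in> T"
  shows "S = T"
  using assms by (metis set_eqI)

lemma deg_toggle:
  assumes "finite F"
  shows "deg (toggle e F) w =
    (if w \<notin> e then deg F w else if e \<in> F then deg F w - 1 else Suc (deg F w))"
  using deg_insert[OF assms, of e w] deg_remove[OF assms, of e w] by (auto simp: toggle_def)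

lemma deg_pos:
  assumes "finite F" "e \<in> F" "w \<in> e"
  shows "0 < deg F w"
  using assms by (auto simp: deg_def card_gt_0_iff)

section \<open>Feasible and optimal subgraphs and the sets \<open>D\<close> and
  \<open>A\<close>\<close>

locale even_capacity_graph =
  fixes V :: "'a set" and E :: "'a set set" and f :: "'a \<Rightarrow> nat"
  assumes finite_V: "finite V"
    and edge_subset: "\<And>e. e \<in> E \<Longrightarrow> e \<subseteq> V"
    and edge_card: "\<And>e. e \<in> E \<Longrightarrow> card e = 2"
    and even_f: "\<And>v. v \<in> V \<Longrightarrow> even (f v)"
begin

definition feasible :: "'a set set \<Rightarrow> bool" where
  "feasible F \<longleftrightarrow> F \<subseteq> E \<and> (\<forall>v\<in>V. deg F v \<le> f v)"

definition bad :: "'a set set \<Rightarrow> 'a set" where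
  "bad F = {v \<in> V. even (deg F v) \<and> deg F v < f v}"

definition full :: "'a set set \<Rightarrow> 'a set" where
  "full F = {v \<in> V. deg F v = f v}"

definition optimal :: "'a set set \<Rightarrow> bool" where
  "optimal F \<longleftrightarrow> feasible F \<and> (\<forall>F'. feasible F' \<longrightarrow> card (bad F) \<le> card (bad F'))"

text \<open>\<open>D\<close> and \<open>A\<close> play the roles of the sets of the same names in the Gallai--Edmonds decomposition.\<close>
definition D :: "'a set" where
  "D = {v. \<exists>F. optimal F \<and> v \<in> bad F}"

definition A :: "'a set" where
  "A = {a \<in> V - D. \<exists>v\<in>D. {v, a} \<in> E}"

lemma finite_E: "finite E"
  by (rule finite_subset[of _ "Pow V"]) (use finite_V edge_subset in auto)

lemma feasible_finite: "feasible F \<Longrightarrow> finite F"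
  using finite_E finite_subset by (auto simp: feasible_def)

lemma finite_bad [simp]: "finite (bad F)"
  using finite_V by (simp add: bad_def)

lemma bad_V: "v \<in> bad F \<Longrightarrow> v \<in> V"
  by (simp add: bad_def)

lemma full_not_bad: "v \<in> full F \<Longrightarrow> v \<notin> bad F"
  by (simp add: full_def bad_def)

lemma deg_outside: "F \<subseteq> E \<Longrightarrow> v \<notin> V \<Longrightarrow> deg F v = 0"
  using edge_subset by (simp add: deg_def) (metis (no_types, lifting) card.empty empty_Collect_eq subsetD)

lemma odd_degI: "feasible F \<Longrightarrow> v \<in> V \<Longrightarrow> v \<notin> bad F \<Longrightarrow> v \<notin> full F \<Longrightarrow> odd (deg F v) \<and> deg F v < f v"
  by (auto simp: feasible_def bad_def full_def le_less)

lemma optimal_feasible: "optimal F \<Longrightarrow> feasible F"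
  by (simp add: optimal_def)

lemma optimal_le: "optimal F \<Longrightarrow> feasible F' \<Longrightarrow> card (bad F) \<le> card (bad F')"
  by (simp add: optimal_def)

lemma optimal_card_eq: "optimal F \<Longrightarrow> optimal F' \<Longrightarrow> card (bad F) = card (bad F')"
  by (meson optimal_def le_antisym)

lemma optimalI: "optimal F \<Longrightarrow> feasible F' \<Longrightarrow> card (bad F') \<le> card (bad F) \<Longrightarrow> optimal F'"
  by (meson optimal_def le_trans)

lemma D_I: "optimal F \<Longrightarrow> v \<in> bad F \<Longrightarrow> v \<in> D"
  by (auto simp: D_def)

lemma D_E:
  assumes "v \<in> D"
  obtains F where "optimal F" "v \<in> bad F"
  using assms by (auto simp: D_def)

lemma D_V: "D \<subseteq> V"
  by (auto simp: D_def bad_def)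

lemma optimal_exists: "\<exists>F. optimal F"
proof -
  have "feasible {}" by (simp add: feasible_def deg_def)
  then have "\<exists>F. feasible F \<and> (\<forall>F'. feasible F' \<longrightarrow> card (bad F) \<le> card (bad F'))"
    using ex_has_least_nat[of feasible "{}" "\<lambda>F. card (bad F)"] by blast
  then show ?thesis by (simp add: optimal_def)
qed

section \<open>Moving bad vertices, the tokens, towards those of another subgraph\<close>

text \<open>The l1 distance of the degree sequences on \<open>V\<close>: at most one of the two
  truncated differences is nonzero. It is the measure that bounds repeated exchanges.\<close>

definition dist_to :: "'a set set \<Rightarrow> 'a set set \<Rightarrow> nat" where
  "dist_to F' F = (\<Sum>v\<in>V. (deg F v - deg F' v) + (deg F' v - deg F v))"

text \<open>Any other outcome of an exchange step at \<open>y\<close> lowers the number of bad vertices, by two against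
  \<open>H1\<close> or by one against \<open>H2\<close>; so the badness of \<open>y\<close> passes like a token to an odd, non-full vertex.\<close>
lemma token_step:
  assumes F: "feasible F" and F': "feasible F'" and y: "y \<in> bad F" "deg F y \<noteq> deg F' y" "y \<notin> Z"
    and Z: "Z \<subseteq> bad F"
    and H1: "\<And>F2. feasible F2 \<Longrightarrow> card (bad F) \<le> Suc (card (bad F2))"
    and H2: "\<And>F2. feasible F2 \<Longrightarrow> Z \<subseteq> bad F2 \<Longrightarrow> card (bad F) \<le> card (bad F2)"
  obtains F2 where "feasible F2" "Z \<subseteq> bad F2" "card (bad F2) = card (bad F)" "full F2 = full F"
    "dist_to F' F2 < dist_to F' F"
proof -
  have "\<exists>F2 c. F2 \<subseteq> F \<union> F' \<and> toward (deg F) (deg F') y c \<noteq> deg F' c \<and>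
    deg F2 = toward (toward (deg F) (deg F') y) (deg F') c"
    using F F' y feasible_finite edge_card by (intro exchange_step) (auto simp: feasible_def)
  then obtain F2 c where F2: "F2 \<subseteq> F \<union> F'" and c: "toward (deg F) (deg F') y c \<noteq> deg F' c"
    and d2: "deg F2 = toward (toward (deg F) (deg F') y) (deg F') c" by blast
  have yV: "y \<in> V" using y bad_V by blast
  have F2E: "F2 \<subseteq> E" using F2 F F' by (auto simp: feasible_def)
  have le: "deg F v \<le> f v" "deg F' v \<le> f v" if "v \<in> V" for v
    using that F F' by (auto simp: feasible_def)
  have fe: "even (f v)" if "v \<in> V" for v using that even_f by blast
  have cV: "c \<in> V"
  proof (rule ccontr)
    assume n: "c \<notin> V"
    then have "deg F c = 0" "deg F' c = 0" using deg_outside F F' by (auto simp: feasible_def)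
    moreover have "c \<noteq> y" using n yV by blast
    ultimately show False using c by (simp add: toward_def)
  qed
  \<comment> \<open>Both steps approach \<open>deg F'\<close> without passing it, so degrees stay
    between those of two feasible subgraphs.\<close>
  have between: "deg F2 v \<le> f v" if "v \<in> V" for v
    using that le[OF that] c y by (auto simp: d2 toward_def split: if_splits)
  have feas2: "feasible F2" using F2E between by (simp add: feasible_def)
  have dist: "dist_to F' F2 < dist_to F' F"
    unfolding dist_to_def
  proof (rule sum_strict_mono_ex1[OF finite_V])
    show "\<forall>v\<in>V. (deg F2 v - deg F' v) + (deg F' v - deg F2 v) \<le> (deg F v - deg F' v) + (deg F' v - deg F v)"
      using y c by (auto simp: d2 toward_def)
    show "\<exists>v\<in>V. (deg F2 v - deg F' v) + (deg F' v - deg F2 v) < (deg F v - deg F' v) + (deg F' v - deg F v)"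
      by (rule bexI[OF _ yV]) (use y c in \<open>auto simp: d2 toward_def\<close>)
  qed
  have ybad: "even (deg F y)" "deg F y < f y" using y by (auto simp: bad_def)
  have same: "deg F2 v = deg F v" if "v \<noteq> y" "v \<noteq> c" for v using that by (simp add: d2 toward_def)
  have status: "v \<in> bad F2 \<longleftrightarrow> v \<in> bad F" "v \<in> full F2 \<longleftrightarrow> v \<in> full F" if "v \<noteq> y" "v \<noteq> c" for v
    using same[OF that] by (auto simp: bad_def full_def)
  have contra: False if "bad F2 = bad F - {y}"
  proof -
    have "Z \<subseteq> bad F2" using that Z y by auto
    from H2[OF feas2 this] have "card (bad F) \<le> card (bad F - {y})" using that by simp
    then show False using y card_Diff1_less[of "bad F" y] by simp
  qed
  show thesis
  proof (cases "c = y")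
    case True
    \<comment> \<open>The two steps at \<open>y\<close> have the same direction, so its degree
      changes by two. Either \<open>y\<close> stays bad or it becomes full, and
      \<open>contra\<close> excludes the latter.\<close>
    have ev: "even (deg F2 y)" using ybad c y True by (auto simp: d2 toward_def split: if_splits)
    show thesis
    proof (cases "deg F2 y < f y")
      case lt: True
      have "y \<in> bad F2" "y \<notin> full F2" "y \<notin> full F"
        using lt ev yV ybad by (auto simp: bad_def full_def)
      then have "v \<in> bad F2 \<longleftrightarrow> v \<in> bad F" "v \<in> full F2 \<longleftrightarrow> v \<in> full F" for v
        using status[of v] True y by (cases "v = y"; simp)+
      then have "bad F2 = bad F" "full F2 = full F" by auto
      then show thesis using that feas2 dist Z by simp
    next
      case False
      then have "y \<notin> bad F2" by (simp add: bad_def)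
      then have "v \<in> bad F2 \<longleftrightarrow> v \<in> bad F - {y}" for v
        using status[of v] True by (cases "v = y") auto
      then show thesis using contra by blast
    qed
  next
    case False
    have oy: "odd (deg F2 y)" using ybad y False by (auto simp: d2 toward_def split: if_splits)
    have y2: "y \<notin> bad F2" "y \<notin> full F2" "y \<notin> full F"
      using oy fe[OF yV] ybad by (auto simp: bad_def full_def)
    have pc: "even (deg F2 c) \<longleftrightarrow> odd (deg F c)"
      using c False by (auto simp: d2 toward_def split: if_splits)
    show thesis
    proof (cases "c \<in> bad F")
      case True
      have "c \<notin> bad F2" using pc True by (auto simp: bad_def)
      then have "bad F2 = bad F - {y} - {c}"
        by (intro set_eq_offI[of y c]) (use status y2 in auto)
      moreover have "Suc (card (bad F - {y} - {c})) < card (bad F)"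
        using True y False card_Suc_Diff1[of "bad F" y] card_Suc_Diff1[of "bad F - {y}" c] by simp
      ultimately have False using H1[OF feas2] by simp
      then show thesis by blast
    next
      case cn: False
      show thesis
      proof (cases "c \<in> bad F2")
        case True
        have eq: "bad F2 = insert c (bad F - {y})"
          by (intro set_eq_offI[of y c]) (use status y2 True \<open>c \<noteq> y\<close> in auto)
        have "card (bad F2) = card (bad F)" unfolding eq by (rule card_swap[OF finite_bad y(1) cn])
        moreover have "c \<notin> full F2" using True full_not_bad by blast
        \<comment> \<open>\<open>c\<close> is even in \<open>F2\<close>, so it was odd in
          \<open>F\<close>, whereas full degrees are even.\<close>
        moreover have "c \<notin> full F" using pc True fe[OF cV] by (auto simp: bad_def full_def)
        ultimately have "full F2 = full F"
          by (intro set_eq_offI[of y c]) (use status y2 in auto)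
        moreover have "Z \<subseteq> bad F2" using eq Z y by auto
        ultimately show thesis using that feas2 dist \<open>card (bad F2) = card (bad F)\<close> by blast
      next
        case False
        then have "bad F2 = bad F - {y}"
          by (intro set_eq_offI[of y c]) (use status y2 cn in auto)
        then show thesis using contra by blast
      qed
    qed
  qed
qed

text \<open>A token outside \<open>Z\<close> that is not bad in \<open>F'\<close> has a different
  degree there, so \<open>token_step\<close> applies and brings \<open>F\<close> closer to
  \<open>F'\<close>. The tokens in \<open>Z\<close> are held fixed throughout. The two minimality
  conditions survive because the number of bad vertices is constant.\<close>

lemma tokens_transfer:
  assumes "feasible F" and F': "feasible F'" and "Z \<subseteq> bad F"
    and "\<And>F2. feasible F2 \<Longrightarrow> card (bad F) \<le> Suc (card (bad F2))"
    and "\<And>F2. feasible F2 \<Longrightarrow> Z \<subseteq> bad F2 \<Longrightarrow> card (bad F) \<le> card (bad F2)"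
  obtains F2 where "feasible F2" "Z \<subseteq> bad F2" "card (bad F2) = card (bad F)" "full F2 = full F"
    "bad F2 - Z \<subseteq> bad F'"
proof -
  have "\<exists>F2. feasible F2 \<and> Z \<subseteq> bad F2 \<and> card (bad F2) = card (bad F) \<and> full F2 = full F \<and>
    bad F2 - Z \<subseteq> bad F'"
    using assms(1,3,4,5)
  proof (induction "dist_to F' F" arbitrary: F rule: less_induct)
    case less
    show ?case
    proof (cases "bad F - Z \<subseteq> bad F'")
      case True
      then show ?thesis using less.prems by blast
    next
      case False
      then obtain y where y: "y \<in> bad F" "y \<notin> Z" "y \<notin> bad F'" by blast
      then have ne: "deg F y \<noteq> deg F' y" by (auto simp: bad_def)
      obtain F2 where F2: "feasible F2" "Z \<subseteq> bad F2" "card (bad F2) = card (bad F)" "full F2 = full F"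
        "dist_to F' F2 < dist_to F' F"
        using token_step[OF less.prems(1) F' y(1) ne y(2) less.prems(2)] less.prems(3,4) by blast
      have "\<exists>F3. feasible F3 \<and> Z \<subseteq> bad F3 \<and> card (bad F3) = card (bad F2) \<and> full F3 = full F2 \<and>
        bad F3 - Z \<subseteq> bad F'"
        using less.hyps[OF F2(5,1,2)] less.prems F2(3) by simp
      then show ?thesis using F2 by simp
    qed
  qed
  then show thesis using that by blast
qed

section \<open>Toggling a single edge at a bad vertex\<close>

text \<open>Toggling makes the even vertex \<open>u\<close> odd, and \<open>u\<close> has room for
  one more edge; the condition on \<open>z\<close> rules out adding an edge at a full vertex. Since
  \<open>z\<close> changes parity too, the token of \<open>u\<close> moves to \<open>z\<close>,
  vanishes, or cancels with one already at \<open>z\<close>.\<close>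

lemma toggle_token:
  fixes F u z
  defines "T \<equiv> toggle {u, z} F"
  assumes F: "feasible F" and u: "u \<in> bad F" and e: "{u, z} \<in> E" and z: "z \<notin> full F \<or> {u, z} \<in> F"
  shows "z \<noteq> u" "feasible T"
    "z \<in> bad T \<Longrightarrow> bad T = insert z (bad F - {u})"
    "z \<notin> bad T \<Longrightarrow> bad T = bad F - {u} - {z}"
    "z \<notin> full F \<Longrightarrow> z \<notin> full T \<Longrightarrow> full T = full F"
    "z \<in> bad F \<Longrightarrow> z \<notin> bad T"
proof -
  have fin: "finite F" using F feasible_finite by blast
  have V: "u \<in> V" "z \<in> V" using edge_subset[OF e] by auto
  show zu: "z \<noteq> u" using edge_card[OF e] by auto
  have deg: "deg T w = (if w \<notin> {u, z} then deg F w else if {u, z} \<in> F then deg F w - 1 else Suc (deg F w))" for w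
    unfolding T_def by (rule deg_toggle[OF fin])
  have pos: "0 < deg F u" "0 < deg F z" if "{u, z} \<in> F"
    using deg_pos[OF fin that] by auto
  have ev: "even (f u)" "even (f z)" using V even_f by auto
  have du: "even (deg F u)" "deg F u < f u" using u by (auto simp: bad_def)
  have oT: "odd (deg T u)" using du pos by (auto simp: deg)
  then have uT: "u \<notin> bad T" "u \<notin> full T" using ev by (auto simp: bad_def full_def)
  have le: "deg F w \<le> f w" if "w \<in> V" for w using F that by (auto simp: feasible_def)
  show "feasible T"
    unfolding feasible_def
  proof (intro conjI ballI)
    show "T \<subseteq> E" using F e by (auto simp: T_def toggle_def feasible_def)
    fix w assume w: "w \<in> V"
    show "deg T w \<le> f w"
      using le[OF w] du z w by (cases "w = z") (auto simp: deg full_def Suc_le_eq le_less)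
  qed
  have other: "w \<in> bad T \<longleftrightarrow> w \<in> bad F" "w \<in> full T \<longleftrightarrow> w \<in> full F" if "w \<noteq> u" "w \<noteq> z" for w
    using that by (auto simp: bad_def full_def deg)
  have uF: "u \<notin> full F" using u full_not_bad by blast
  show "bad T = insert z (bad F - {u})" if "z \<in> bad T"
  proof (rule set_eqI)
    fix w show "w \<in> bad T \<longleftrightarrow> w \<in> insert z (bad F - {u})"
      using that other(1)[of w] uT zu by (cases "w = u"; cases "w = z") auto
  qed
  show "bad T = bad F - {u} - {z}" if "z \<notin> bad T"
  proof (rule set_eqI)
    fix w show "w \<in> bad T \<longleftrightarrow> w \<in> bad F - {u} - {z}"
      using that other(1)[of w] uT zu by (cases "w = u"; cases "w = z") auto
  qed
  show "full T = full F" if "z \<notin> full F" "z \<notin> full T"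
  proof (rule set_eqI)
    fix w show "w \<in> full T \<longleftrightarrow> w \<in> full F"
      using that other(2)[of w] uT uF by (cases "w = u"; cases "w = z") auto
  qed
  have pz: "even (deg T z) \<longleftrightarrow> odd (deg F z)" using pos by (auto simp: deg)
  show "z \<notin> bad T" if "z \<in> bad F" using that pz by (auto simp: bad_def)
qed

lemma toggle_two_tokens:
  assumes F: "feasible F" and uz: "u \<in> bad F" "z \<in> bad F" and e: "{u, z} \<in> E"
  shows "feasible (toggle {u, z} F)" "Suc (Suc (card (bad (toggle {u, z} F)))) = card (bad F)"
proof -
  have nf: "z \<notin> full F" using uz full_not_bad by blast
  have h: "z \<notin> full F \<or> {u, z} \<in> F" using nf by blast
  note t = toggle_token[OF F uz(1) e h]
  show "feasible (toggle {u, z} F)" by (rule t(2))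
  have "bad (toggle {u, z} F) = bad F - {u} - {z}" by (rule t(4)[OF t(6)[OF uz(2)]])
  then show "Suc (Suc (card (bad (toggle {u, z} F)))) = card (bad F)"
    using t(1) uz card_Suc_Diff1[of "bad F" u] card_Suc_Diff1[of "bad F - {u}" z] by simp
qed

lemma remove_edge:
  fixes F x a
  defines "F1 \<equiv> F - {{x, a}}"
  assumes F: "feasible F" and e: "{x, a} \<in> F"
  shows "x \<noteq> a" "feasible F1" "\<And>w. w \<noteq> x \<Longrightarrow> w \<noteq> a \<Longrightarrow> deg F1 w = deg F w"
    "Suc (deg F1 x) = deg F x" "Suc (deg F1 a) = deg F a"
proof -
  have fin: "finite F" using F feasible_finite by blast
  have "card {x, a} = 2" using F e edge_card by (auto simp: feasible_def)
  then show ne: "x \<noteq> a" by auto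
  have d: "deg F w = (if w \<in> {x, a} then Suc (deg F1 w) else deg F1 w)" for w
    unfolding F1_def by (rule deg_remove[OF fin e])
  show "deg F1 w = deg F w" if "w \<noteq> x" "w \<noteq> a" for w using d[of w] that by simp
  show "Suc (deg F1 x) = deg F x" "Suc (deg F1 a) = deg F a" using d by auto
  have "deg F1 w \<le> deg F w" for w by (simp add: d)
  then show "feasible F1" using F le_trans unfolding feasible_def F1_def by (meson Diff_subset subset_trans)
qed

section \<open>How \<open>D\<close> and \<open>A\<close> behave in optimal subgraphs\<close>

text \<open>For optimal subgraphs \<open>tokens_transfer\<close> works with \<open>Z\<close> empty,
  and equal cardinality turns its inclusion into an equality.\<close>

lemma optimal_transfer:
  assumes F: "optimal F" and F': "optimal F'"
  obtains F2 where "optimal F2" "bad F2 = bad F'" "full F2 = full F"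
proof -
  have H: "card (bad F) \<le> card (bad F2)" "card (bad F) \<le> Suc (card (bad F2))" if "feasible F2" for F2
    using optimal_le[OF F that] by auto
  obtain F2 where F2: "feasible F2" "card (bad F2) = card (bad F)" "full F2 = full F" "bad F2 - {} \<subseteq> bad F'"
    by (rule tokens_transfer[OF optimal_feasible[OF F] optimal_feasible[OF F'] empty_subsetI H(2) H(1)]) blast+
  have "bad F2 = bad F'"
    using F2 optimal_card_eq[OF F F'] by (simp add: card_subset_eq)
  moreover have "optimal F2" using optimalI[OF F] F2 by simp
  ultimately show thesis using that F2 by blast
qed

text \<open>Transferring \<open>F\<close> to an optimal subgraph in which \<open>w\<close> is bad
  would make \<open>w\<close> bad while keeping it full.\<close>

lemma D_not_full:
  assumes F: "optimal F" and w: "w \<in> D"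
  shows "w \<notin> full F"
proof
  assume full: "w \<in> full F"
  obtain F' where F': "optimal F'" "w \<in> bad F'" using w D_E by blast
  obtain F2 where F2: "optimal F2" "bad F2 = bad F'" "full F2 = full F"
    using optimal_transfer[OF F F'(1)] by blast
  then have "w \<in> bad F2" using F' by simp
  then show False using full F2 full_not_bad by blast
qed

text \<open>If either claim failed, the edge could be toggled. This would make \<open>a\<close> bad
  in an optimal subgraph, against \<open>a \<notin> D\<close>, or lower the number of bad
  vertices.\<close>

lemma optimal_token_edge:
  assumes F: "optimal F" and x: "x \<in> bad F" and e: "{x, a} \<in> E" and a: "a \<notin> D"
  shows "{x, a} \<notin> F" "a \<in> full F"
proof -
  have fs: "feasible F" using F optimal_feasible by blast
  have "\<not> (a \<in> full F \<longrightarrow> {x, a} \<in> F)"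
  proof
    assume "a \<in> full F \<longrightarrow> {x, a} \<in> F"
    then have h: "a \<notin> full F \<or> {x, a} \<in> F" by blast
    note t = toggle_token[OF fs x e h]
    have an: "a \<notin> bad F" using a D_I[OF F] by blast
    show False
    proof (cases "a \<in> bad (toggle {x, a} F)")
      case True
      have "card (bad (toggle {x, a} F)) = card (bad F)"
        unfolding t(3)[OF True] by (rule card_swap[OF finite_bad x an])
      then have "optimal (toggle {x, a} F)" using optimalI[OF F t(2)] by simp
      then show False using D_I True a by blast
    next
      case False
      have "bad (toggle {x, a} F) = bad F - {x}" using t(4)[OF False] an by blast
      then have "card (bad (toggle {x, a} F)) < card (bad F)"
        using x by (metis card_Diff1_less finite_bad)
      then show False using optimal_le[OF F t(2)] by simp
    qed
  qed
  then show "{x, a} \<notin> F" "a \<in> full F" by auto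
qed

lemma A_E:
  assumes "a \<in> A"
  obtains v F where "optimal F" "v \<in> bad F" "v \<in> D" "{v, a} \<in> E" "a \<in> V" "a \<notin> D"
proof -
  obtain v where v: "v \<in> D" "{v, a} \<in> E" using assms by (auto simp: A_def)
  obtain F where "optimal F" "v \<in> bad F" using v D_E by blast
  then show thesis using that v assms by (auto simp: A_def)
qed

text \<open>A transfer that keeps the full vertices makes some neighbour of \<open>a\<close> bad,
  and then \<open>optimal_token_edge\<close> applies.\<close>

lemma A_full:
  assumes F: "optimal F" and a: "a \<in> A"
  shows "a \<in> full F"
proof -
  obtain v F' where v: "optimal F'" "v \<in> bad F'" "{v, a} \<in> E" "a \<notin> D" using A_E[OF a] by metis
  obtain F2 where F2: "optimal F2" "bad F2 = bad F'" "full F2 = full F"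
    using optimal_transfer[OF F v(1)] by blast
  then have "a \<in> full F2" using optimal_token_edge v by blast
  then show ?thesis using F2 by simp
qed

text \<open>As \<open>a\<close> is outside \<open>D\<close>, the excess over the minimum is at least
  one. If it were exactly one, \<open>a\<close> could be held fixed while the other tokens move onto
  those of an optimal subgraph in which a neighbour \<open>v\<close> of \<open>a\<close> is bad.
  Toggling the edge \<open>va\<close> would cancel two tokens and undercut the minimum.\<close>

lemma A_bad_excess:
  assumes a: "a \<in> A" and F: "feasible F" "a \<in> bad F" and opt: "optimal F0"
  shows "Suc (card (bad F0)) < card (bad F)"
proof (rule ccontr)
  assume "\<not> ?thesis"
  then have le: "card (bad F) \<le> Suc (card (bad F0))" by simp
  obtain v F' where v: "optimal F'" "v \<in> bad F'" "v \<in> D" "{v, a} \<in> E" "a \<notin> D" using A_E[OF a] by metis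
  have H2: "Suc (card (bad F0)) \<le> card (bad F2)" if "feasible F2" "{a} \<subseteq> bad F2" for F2
  proof (rule ccontr)
    assume "\<not> ?thesis"
    then have "optimal F2" using optimalI[OF opt] that by simp
    then show False using D_I that v by blast
  qed
  have H1: "card (bad F0) \<le> card (bad F2)" if "feasible F2" for F2 using optimal_le[OF opt that] .
  have c: "card (bad F) = Suc (card (bad F0))" using le H2[OF F(1)] F(2) by simp
  have H: "card (bad F) \<le> Suc (card (bad F2))" if "feasible F2" for F2 using c H1[OF that] by simp
  have H': "card (bad F) \<le> card (bad F2)" if "feasible F2" "{a} \<subseteq> bad F2" for F2 using c H2[OF that] by simp
  have "{a} \<subseteq> bad F" using F by simp
  then obtain F2 where F2: "feasible F2" "{a} \<subseteq> bad F2" "card (bad F2) = card (bad F)"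
    "bad F2 - {a} \<subseteq> bad F'"
    by (rule tokens_transfer[OF F(1) optimal_feasible[OF v(1)] _ H H']) blast+
  have "card (bad F2 - {a}) = card (bad F')" using c F2(2,3) optimal_card_eq[OF opt v(1)] by simp
  then have "bad F2 - {a} = bad F'" using F2(4) by (simp add: card_subset_eq)
  then have "v \<in> bad F2" using v by blast
  then show False
    using toggle_two_tokens[OF F2(1) _ _ v(4)] F2(2,3) c H1 by fastforce
qed

section \<open>Moving tokens inside \<open>D\<close>, and edges leaving its components\<close>

definition adjD :: "('a \<times> 'a) set" where
  "adjD = {(x, y). x \<in> D \<and> y \<in> D \<and> {x, y} \<in> E}"

lemma adjD_in_D: "(x, y) \<in> adjD\<^sup>* \<Longrightarrow> x \<in> D \<Longrightarrow> y \<in> D"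
  by (induction rule: rtrancl_induct) (auto simp: adjD_def)

text \<open>The edges of a path inside \<open>D\<close> are toggled in turn; each time the next
  vertex is not full, and minimality forbids cancelling or losing the token. Minimality is required
  only among subgraphs that agree with \<open>F\<close> on edges not inside \<open>D\<close>, so
  that the lemma also covers the non-optimal \<open>F1\<close> in
  \<open>component_one_exit\<close>.\<close>

lemma token_move:
  assumes "(x, y) \<in> adjD\<^sup>*" and F: "feasible F" and x: "x \<in> bad F" and nf: "full F \<inter> D = {}"
    and H: "\<And>F2. feasible F2 \<Longrightarrow> (\<And>e. \<not> e \<subseteq> D \<Longrightarrow> e \<in> F2 \<longleftrightarrow> e \<in> F) \<Longrightarrow> card (bad F) \<le> card (bad F2)"
  shows "\<exists>F2. feasible F2 \<and> (\<forall>e. \<not> e \<subseteq> D \<longrightarrow> (e \<in> F2 \<longleftrightarrow> e \<in> F)) \<and>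
    bad F2 = insert y (bad F - {x}) \<and> card (bad F2) = card (bad F) \<and> full F2 = full F"
  using assms(1)
proof (induction rule: rtrancl_induct)
  case base
  then show ?case using F x by (intro exI[of _ F]) auto
next
  case (step y z)
  then obtain F2 where F2: "feasible F2" "\<forall>e. \<not> e \<subseteq> D \<longrightarrow> (e \<in> F2 \<longleftrightarrow> e \<in> F)"
    "bad F2 = insert y (bad F - {x})" "card (bad F2) = card (bad F)" "full F2 = full F" by blast
  have yz: "y \<in> D" "z \<in> D" "{y, z} \<in> E" using step.hyps by (auto simp: adjD_def)
  have zf: "z \<notin> full F2" using yz nf F2 by auto
  have y2: "y \<in> bad F2" using F2 by simp
  have h: "z \<notin> full F2 \<or> {y, z} \<in> F2" using zf by blast
  note t = toggle_token[OF F2(1) y2 yz(3) h]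
  let ?T = "toggle {y, z} F2"
  have out: "e \<in> ?T \<longleftrightarrow> e \<in> F" if "\<not> e \<subseteq> D" for e using that F2(2) yz by (auto simp: toggle_def)
  have le: "card (bad F2) \<le> card (bad ?T)" using H[OF t(2) out] F2(4) by simp
  have zb: "z \<notin> bad F2" using toggle_two_tokens(2)[OF F2(1) y2 _ yz(3)] le by fastforce
  have zT: "z \<in> bad ?T"
  proof (rule ccontr)
    assume "z \<notin> bad ?T"
    from t(4)[OF this] have "bad ?T = bad F2 - {y}" using zb by blast
    then show False using le y2 by (metis card_Diff1_less finite_bad not_le)
  qed
  have bT: "bad ?T = insert z (bad F2 - {y})" by (rule t(3)[OF zT])
  \<comment> \<open>Had the moving token met another one at \<open>y\<close>, the count would have
    dropped.\<close>
  have yx: "y \<notin> bad F - {x}"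
  proof
    assume "y \<in> bad F - {x}"
    then have "bad F2 = bad F - {x}" using F2 by auto
    then show False using F2(4) x by (metis card_Diff1_less finite_bad less_irrefl)
  qed
  have "bad ?T = insert z (bad F - {x})" using bT F2(3) yx by auto
  moreover have "card (bad ?T) = card (bad F2)"
    unfolding bT by (rule card_swap[OF finite_bad y2 zb])
  moreover have "full ?T = full F2"
    by (rule t(5)[OF zf]) (use zT full_not_bad in blast)
  ultimately show ?case using t(2) out F2 by (intro exI[of _ ?T]) auto
qed

lemma optimal_token_move:
  assumes r: "(x, y) \<in> adjD\<^sup>*" and F: "optimal F" and x: "x \<in> bad F"
  shows "\<exists>F2. optimal F2 \<and> (\<forall>e. \<not> e \<subseteq> D \<longrightarrow> (e \<in> F2 \<longleftrightarrow> e \<in> F)) \<and>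
    bad F2 = insert y (bad F - {x}) \<and> card (bad F2) = card (bad F)"
proof -
  have nf: "full F \<inter> D = {}" using D_not_full[OF F] by blast
  have le: "card (bad F) \<le> card (bad F2)" if "feasible F2" for F2 by (rule optimal_le[OF F that])
  obtain F2 where F2: "feasible F2" "\<forall>e. \<not> e \<subseteq> D \<longrightarrow> (e \<in> F2 \<longleftrightarrow> e \<in> F)"
    "bad F2 = insert y (bad F - {x})" "card (bad F2) = card (bad F)"
    using token_move[OF r optimal_feasible[OF F] x nf le] by blast
  then show ?thesis using optimalI[OF F F2(1)] by auto
qed

text \<open>Moving the token of \<open>x\<close> to \<open>y\<close> would merge it with the token
  already there.\<close>

lemma component_one_token:
  assumes r: "(x, y) \<in> adjD\<^sup>*" and F: "optimal F" and "x \<in> bad F" "y \<in> bad F"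
  shows "x = y"
proof (rule ccontr)
  assume "x \<noteq> y"
  obtain F2 where F2: "bad F2 = insert y (bad F - {x})" "card (bad F2) = card (bad F)"
    using optimal_token_move[OF r F assms(3)] by blast
  from F2(1) have "bad F2 = bad F - {x}" using assms \<open>x \<noteq> y\<close> by auto
  then show False using F2(2) assms by (metis card_Diff1_less finite_bad less_irrefl)
qed

text \<open>The token can be moved to \<open>x\<close> without touching the edge \<open>xa\<close>,
  which \<open>optimal_token_edge\<close> then forbids.\<close>

lemma token_component_no_exit:
  assumes r: "(u, x) \<in> adjD\<^sup>*" and F: "optimal F" and u: "u \<in> bad F" and e: "{x, a} \<in> F" and a: "a \<notin> D"
  shows False
proof -
  obtain F2 where F2: "optimal F2" "\<forall>e. \<not> e \<subseteq> D \<longrightarrow> (e \<in> F2 \<longleftrightarrow> e \<in> F)"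
    "bad F2 = insert x (bad F - {u})"
    using optimal_token_move[OF r F u] by blast
  have "{x, a} \<in> F2" using F2(2) e a by simp
  moreover have "{x, a} \<in> E" using e F optimal_feasible by (auto simp: feasible_def)
  ultimately show False using optimal_token_edge(1)[OF F2(1)] F2(3) a by blast
qed

lemma D_neighbour: "x \<in> D \<Longrightarrow> {x, a} \<in> E \<Longrightarrow> a \<notin> D \<Longrightarrow> a \<in> A"
  using edge_subset by (auto simp: A_def)

lemma A_subset: "A \<subseteq> V" and A_D_disjoint: "A \<inter> D = {}"
  by (auto simp: A_def)

lemma deg_outside_D_cong:
  assumes "\<And>e. \<not> e \<subseteq> D \<Longrightarrow> e \<in> F2 \<longleftrightarrow> e \<in> F" "a \<notin> D"
  shows "deg F2 a = deg F a"
proof -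
  have "{e \<in> F2. a \<in> e} = {e \<in> F. a \<in> e}" using assms by blast
  then show ?thesis by (simp add: deg_def)
qed

lemma status_cong:
  assumes "deg F w = deg F' w"
  shows "w \<in> bad F \<longleftrightarrow> w \<in> bad F'" "w \<in> full F \<longleftrightarrow> w \<in> full F'"
  using assms by (auto simp: bad_def full_def)

text \<open>Removing two exits ending at the same \<open>a\<close> leaves \<open>a\<close> two below its capacity, hence bad, which
  \<open>A_bad_excess\<close> excludes; removing two exits with different ends leaves a non-full vertex
  of \<open>A\<close> in an optimal subgraph.\<close>
lemma component_one_exit:
  assumes F: "optimal F" and e1: "{x1, a1} \<in> F" and e2: "{x2, a2} \<in> F"
    and x: "x1 \<in> D" "x2 \<in> D" and a: "a1 \<notin> D" "a2 \<notin> D" and r: "(x1, x2) \<in> adjD\<^sup>*"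
  shows "{x1, a1} = {x2, a2}"
proof (rule ccontr)
  assume ne: "{x1, a1} \<noteq> {x2, a2}"
  have fs: "feasible F" by (rule optimal_feasible[OF F])
  have A: "a1 \<in> A" "a2 \<in> A"
    using D_neighbour x a e1 e2 fs by (auto simp: feasible_def)
  have V: "x1 \<in> V" "x2 \<in> V" "a1 \<in> V" "a2 \<in> V" using x D_V A A_subset by auto
  have full: "deg F a1 = f a1" "deg F a2 = f a2"
    using A_full[OF F A(1)] A_full[OF F A(2)] by (auto simp: full_def)
  define F1 where "F1 = F - {{x1, a1}}"
  note r1 = remove_edge[OF fs e1, folded F1_def]
  have x1b: "x1 \<notin> bad F" using token_component_no_exit[OF rtrancl_refl F _ e1 a(1)] by blast
  have ox1: "odd (deg F x1)" "deg F x1 < f x1"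
    using odd_degI[OF fs V(1) x1b D_not_full[OF F x(1)]] by auto
  have "even (deg F1 x1)" using ox1(1) unfolding r1(4)[symmetric] by simp
  then have x1b1: "x1 \<in> bad F1" using ox1(2) r1(4) V by (simp add: bad_def)
  have a1o: "odd (deg F1 a1)" using even_f[OF V(3)] full r1(5) by (metis even_Suc)
  then have a1b1: "a1 \<notin> bad F1" "a1 \<notin> bad F" using full by (auto simp: bad_def)
  have b1: "bad F1 = insert x1 (bad F)"
  proof (rule set_eq_offI[of x1 a1])
    fix v assume "v \<noteq> x1" "v \<noteq> a1"
    then show "v \<in> bad F1 \<longleftrightarrow> v \<in> insert x1 (bad F)"
      using status_cong(1)[OF r1(3)] by simp
  qed (use x1b1 a1b1 r1(1) in auto)
  have c1: "card (bad F1) = Suc (card (bad F))" unfolding b1 using x1b by simp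
  have nf: "full F1 \<inter> D = {}"
  proof -
    have "w \<notin> full F1" if w: "w \<in> D" for w
    proof (cases "w = x1")
      case True
      then show ?thesis using x1b1 full_not_bad by blast
    next
      case False
      then have "deg F1 w = deg F w" using r1(3) w a by blast
      then show ?thesis using status_cong(2) D_not_full[OF F w] by blast
    qed
    then show ?thesis by blast
  qed
  \<comment> \<open>A subgraph with fewer bad vertices would be optimal, yet \<open>a1\<close> keeps
    its odd degree from \<open>F1\<close> and so is not full, against \<open>A_full\<close>.\<close>
  have H: "card (bad F1) \<le> card (bad F2)"
    if f2: "feasible F2" and out: "\<And>e. \<not> e \<subseteq> D \<Longrightarrow> e \<in> F2 \<longleftrightarrow> e \<in> F1" for F2
  proof (rule ccontr)
    assume "\<not> ?thesis"
    then have "optimal F2" using optimalI[OF F f2] c1 by simp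
    then have "deg F2 a1 = f a1" using A_full[OF _ A(1)] by (auto simp: full_def)
    then have "deg F1 a1 = f a1" using deg_outside_D_cong[OF out a(1)] by simp
    then show False using a1o even_f[OF V(3)] by simp
  qed
  obtain F2 where F2: "feasible F2" "\<forall>e. \<not> e \<subseteq> D \<longrightarrow> (e \<in> F2 \<longleftrightarrow> e \<in> F1)"
    "bad F2 = insert x2 (bad F1 - {x1})" "card (bad F2) = card (bad F1)" "full F2 = full F1"
    using token_move[OF r r1(2) x1b1 nf H] by blast
  have e2': "{x2, a2} \<in> F2" using F2(2) e2 ne a by (auto simp: F1_def)
  have d2: "deg F2 w = deg F1 w" if "w \<notin> D" for w
    by (rule deg_outside_D_cong[OF _ that]) (use F2(2) in blast)
  \<comment> \<open>The token created at \<open>x1\<close> has been moved to \<open>x2\<close>,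
    where removing the second exit consumes it.\<close>
  define F3 where "F3 = F2 - {{x2, a2}}"
  note r3 = remove_edge[OF F2(1) e2', folded F3_def]
  have x2b: "x2 \<in> bad F2" using F2(3) by simp
  have "odd (deg F3 x2)" using x2b r3(4) by (auto simp: bad_def) (metis even_Suc)
  then have x2b3: "x2 \<notin> bad F3" by (simp add: bad_def)
  have other: "v \<in> bad F3 \<longleftrightarrow> v \<in> bad F2" if "v \<noteq> x2" "v \<noteq> a2" for v
    using status_cong(1)[OF r3(3)[OF that]] .
  show False
  proof (cases "a2 = a1")
    case True
    have "Suc (Suc (deg F3 a1)) = f a1" using d2[OF a(1)] r1(5) r3(5) full True by simp
    moreover from this have "even (deg F3 a1)" using even_f[OF V(3)] by (metis even_Suc)
    ultimately have a3: "a1 \<in> bad F3" using V by (simp add: bad_def)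
    have a2b: "a1 \<notin> bad F2" using status_cong(1)[OF d2[OF a(1)]] a1b1 by simp
    have "bad F3 = insert a1 (bad F2 - {x2})"
      by (rule set_eq_offI[of x2 a2]) (use other x2b3 a3 True r3(1) in auto)
    then have "card (bad F3) = card (bad F2)" using card_swap[OF finite_bad x2b a2b] by simp
    then show False using A_bad_excess[OF A(1) r3(2) a3 F] F2(4) c1 by simp
  next
    case False
    have a2x1: "a2 \<noteq> x1" "a1 \<noteq> x2" using a x by auto
    have f2: "deg F2 a2 = f a2" using d2[OF a(2)] r1(3)[OF a2x1(1) False] full by simp
    have "odd (deg F3 a2)" using f2 r3(5) even_f[OF V(4)] by (metis even_Suc)
    then have "a2 \<notin> bad F3" "a2 \<notin> bad F2" using f2 by (auto simp: bad_def)
    then have "bad F3 = bad F2 - {x2}"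
      by (intro set_eq_offI[of x2 a2]) (use other x2b3 in auto)
    then have "card (bad F3) = card (bad F)" using F2(4) c1 x2b by simp
    then have "optimal F3" using optimalI[OF F r3(2)] by simp
    then have "deg F3 a1 = f a1" using A_full[OF _ A(1)] by (auto simp: full_def)
    then have "deg F1 a1 = f a1" using r3(3)[of a1] a2x1 False d2[OF a(1)] by simp
    then show False using a1o even_f[OF V(3)] by simp
  qed
qed

section \<open>Edges of optimal subgraphs at \<open>A\<close>\<close>

text \<open>If \<open>y\<close> were outside \<open>D\<close>, deleting \<open>ay\<close> would
  leave \<open>a\<close> not full, so by \<open>A_full\<close> it must cost one extra token, at
  \<open>y\<close>. Holding that token fixed, the others are moved until a neighbour
  \<open>v\<close> of \<open>a\<close> is bad, and then \<open>va\<close> is toggled.\<close>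

lemma A_edges_to_D:
  assumes F: "optimal F" and a: "a \<in> A" and e: "{a, y} \<in> F"
  shows "y \<in> D"
proof (rule ccontr)
  assume y: "y \<notin> D"
  have fs: "feasible F" by (rule optimal_feasible[OF F])
  have V: "a \<in> V" "y \<in> V" using e fs edge_subset by (auto simp: feasible_def)
  have full: "deg F a = f a" using A_full[OF F a] by (auto simp: full_def)
  have aD: "a \<notin> D" using a by (auto simp: A_def)
  define F1 where "F1 = F - {{a, y}}"
  note r1 = remove_edge[OF fs e, folded F1_def]
  have ao: "odd (deg F1 a)" using even_f[OF V(1)] full r1(4) by (metis even_Suc)
  have a1: "a \<notin> bad F1" "a \<notin> bad F" "a \<notin> full F1"
    using ao full even_f[OF V(1)] by (auto simp: bad_def full_def)
  have yb: "y \<notin> bad F" using y D_I[OF F] by blast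
  have other: "v \<in> bad F1 \<longleftrightarrow> v \<in> bad F" if "v \<noteq> a" "v \<noteq> y" for v
    using status_cong(1)[OF r1(3)[OF that]] .
  have y1: "y \<in> bad F1"
  proof (rule ccontr)
    assume "y \<notin> bad F1"
    then have "bad F1 = bad F"
      by (intro set_eq_offI[of a y]) (use other a1 yb in auto)
    then have "optimal F1" using optimalI[OF F r1(2)] by simp
    then show False using A_full[OF _ a] a1 by blast
  qed
  have "bad F1 = insert y (bad F)"
    by (rule set_eq_offI[of a y]) (use other a1 y1 r1(1) in auto)
  then have c1: "card (bad F1) = Suc (card (bad F))" using yb by simp
  have H2: "Suc (card (bad F)) \<le> card (bad F2)" if "feasible F2" "y \<in> bad F2" for F2
  proof (rule ccontr)
    assume "\<not> ?thesis"
    then have "optimal F2" using optimalI[OF F] that by simp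
    then show False using D_I that y by blast
  qed
  have H: "card (bad F1) \<le> Suc (card (bad F2))" if "feasible F2" for F2
    using c1 optimal_le[OF F that] by simp
  have H': "card (bad F1) \<le> card (bad F2)" if "feasible F2" "{y} \<subseteq> bad F2" for F2
    using c1 H2[OF that(1)] that(2) by simp
  obtain v F' where v: "optimal F'" "v \<in> bad F'" "v \<in> D" "{v, a} \<in> E" using A_E[OF a] by metis
  have "{y} \<subseteq> bad F1" using y1 by simp
  then obtain F2 where F2: "feasible F2" "{y} \<subseteq> bad F2" "card (bad F2) = card (bad F1)" "full F2 = full F1"
    "bad F2 - {y} \<subseteq> bad F'"
    by (rule tokens_transfer[OF r1(2) optimal_feasible[OF v(1)] _ H H']) blast+
  have "card (bad F2 - {y}) = card (bad F')" using c1 F2(2,3) optimal_card_eq[OF F v(1)] by simp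
  then have beq: "bad F2 - {y} = bad F'" using F2(5) by (simp add: card_subset_eq)
  then have vb: "v \<in> bad F2" using v by blast
  have vy: "v \<noteq> y" using v y by blast
  have af: "a \<notin> full F2 \<or> {v, a} \<in> F2" using F2(4) a1 by simp
  note t = toggle_token[OF F2(1) vb v(4) af]
  let ?T = "toggle {v, a} F2"
  have ab: "a \<notin> bad F2" using beq D_I[OF v(1)] aD r1(1) by blast
  \<comment> \<open>If \<open>a\<close> becomes bad, the excess of only one contradicts
    \<open>A_bad_excess\<close>. Otherwise the token of \<open>v\<close> vanishes, leaving an
    optimal subgraph with \<open>y\<close> bad, although \<open>y \<notin> D\<close>.\<close>
  show False
  proof (cases "a \<in> bad ?T")
    case True
    have "card (bad ?T) = card (bad F2)" unfolding t(3)[OF True] by (rule card_swap[OF finite_bad vb ab])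
    then show False using A_bad_excess[OF a t(2) True F] F2(3) c1 by simp
  next
    case False
    have eq: "bad ?T = bad F2 - {v}" using t(4)[OF False] ab by blast
    then have "y \<in> bad ?T" using F2(2) vy by blast
    from H2[OF t(2) this] show False
      using eq F2(3) c1 card_Suc_Diff1[OF finite_bad vb] by simp
  qed
qed

section \<open>Components of \<open>D\<close>: parity, number, and the case of empty
  \<open>A\<close>\<close>

definition component :: "'a \<Rightarrow> 'a set" where
  "component x = adjD\<^sup>* `` {x}"

lemma component_subset_D: "x \<in> D \<Longrightarrow> component x \<subseteq> D"
  using adjD_in_D by (auto simp: component_def)

text \<open>Choose an optimal \<open>F\<close> with \<open>x\<close> bad. No edge of
  \<open>F\<close> leaves the component, so its degree sum is even; every vertex other than
  \<open>x\<close> is neither bad nor full, hence odd. The number of vertices other than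
  \<open>x\<close> is thus even.\<close>

lemma odd_component:
  assumes x: "x \<in> D"
  shows "odd (card (component x))"
proof -
  let ?K = "component x"
  obtain F where F: "optimal F" "x \<in> bad F" using x D_E by blast
  have fs: "feasible F" by (rule optimal_feasible[OF F(1)])
  have KD: "?K \<subseteq> D" by (rule component_subset_D[OF x])
  have fin: "finite ?K" "finite F"
    using KD D_V finite_V feasible_finite[OF fs] by (auto intro: finite_subset)
  have xK: "x \<in> ?K" by (simp add: component_def)
  have "(\<Sum>v\<in>?K. deg F v) = (\<Sum>v\<in>?K. \<Sum>e\<in>F. if v \<in> e then 1 else 0)"
    using fin by (simp add: deg_def sum.If_cases Int_def)
  also have "\<dots> = (\<Sum>e\<in>F. \<Sum>v\<in>?K. if v \<in> e then 1 else 0)" by (rule sum.swap)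
  also have "\<dots> = (\<Sum>e\<in>F. card (?K \<inter> e))"
    using fin by (simp add: sum.If_cases Int_def)
  finally have sw: "(\<Sum>v\<in>?K. deg F v) = (\<Sum>e\<in>F. card (?K \<inter> e))" .
  have "even (card (?K \<inter> e))" if e: "e \<in> F" for e
  proof (cases "?K \<inter> e = {}")
    case False
    then obtain y where y: "y \<in> ?K" "y \<in> e" by blast
    have eE: "e \<in> E" using e fs by (auto simp: feasible_def)
    obtain z where z: "e = {y, z}" using doubleton_other[OF edge_card[OF eE] y(2)] by metis
    have xy: "(x, y) \<in> adjD\<^sup>*" using y by (simp add: component_def)
    have zD: "z \<in> D" using token_component_no_exit[OF xy F] e z by blast
    have "(y, z) \<in> adjD" using y KD zD eE z by (auto simp: adjD_def)
    then have "z \<in> ?K" using xy by (auto simp: component_def)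
    then have "?K \<inter> e = e" using y z by blast
    then show ?thesis using edge_card[OF eE] by simp
  qed simp
  then have "even (\<Sum>v\<in>?K. deg F v)" unfolding sw by (rule dvd_sum)
  then have ev: "even (card {v \<in> ?K. odd (deg F v)})" using even_sum_iff[OF fin(1)] by blast
  have "{v \<in> ?K. odd (deg F v)} = ?K - {x}"
  proof (intro equalityI subsetI)
    fix v assume "v \<in> {v \<in> ?K. odd (deg F v)}"
    then show "v \<in> ?K - {x}" using F(2) by (auto simp: bad_def)
  next
    fix v assume v: "v \<in> ?K - {x}"
    then have "v \<notin> bad F" using component_one_token[OF _ F] by (auto simp: component_def)
    moreover have "v \<notin> full F" "v \<in> V" using D_not_full[OF F(1)] v KD D_V by auto
    ultimately have "odd (deg F v)" using odd_degI[OF fs] by blast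
    then show "v \<in> {v \<in> ?K. odd (deg F v)}" using v by blast
  qed
  then show ?thesis using ev card_Suc_Diff1[OF fin(1) xK] by (metis even_Suc)
qed

text \<open>The \<open>F\<close>-edges at \<open>A\<close> number \<open>f(A)\<close> and enter
  distinct components of \<open>D\<close>. The bad vertices lie in distinct components too, and
  these are not entered by any such edge.\<close>

lemma comps_exceed:
  assumes F: "optimal F"
  shows "sum f A + card (bad F) \<le> card (component ` D)"
proof -
  have fs: "feasible F" by (rule optimal_feasible[OF F])
  have fin: "finite F" "finite A" "finite D"
    using feasible_finite[OF fs] A_subset D_V finite_V by (auto intro: finite_subset)
  define L where "L = {e \<in> F. e \<inter> A \<noteq> {}}"
  have LE: "\<exists>a x. e = {x, a} \<and> a \<in> A \<and> x \<in> D" if eL: "e \<in> L" for e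
  proof -
    obtain a where a: "e \<in> F" "a \<in> e" "a \<in> A" using eL unfolding L_def by blast
    have "e \<in> E" using a fs by (auto simp: feasible_def)
    then obtain x where x: "e = {a, x}" using doubleton_other[OF edge_card a(2)] by metis
    have "x \<in> D" using A_edges_to_D[OF F a(3)] a(1) x by blast
    then show ?thesis using x a(3) by (intro exI[of _ a] exI[of _ x]) auto
  qed
  \<comment> \<open>Vertices of \<open>A\<close> are full, and no edge is counted twice because the
    other end of an \<open>F\<close>-edge at \<open>A\<close> lies in \<open>D\<close>.\<close>
  have "sum f A = (\<Sum>a\<in>A. deg F a)"
    using A_full[OF F] by (intro sum.cong) (auto simp: full_def)
  also have "\<dots> = card (\<Union>a\<in>A. {e \<in> F. a \<in> e})"
    unfolding deg_def
  proof (rule card_UN_disjoint[symmetric])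
    show "\<forall>i\<in>A. \<forall>j\<in>A. i \<noteq> j \<longrightarrow> {e \<in> F. i \<in> e} \<inter> {e \<in> F. j \<in> e} = {}"
    proof (intro ballI impI equals0I)
      fix i j e assume ij: "i \<in> A" "j \<in> A" "i \<noteq> j" "e \<in> {e \<in> F. i \<in> e} \<inter> {e \<in> F. j \<in> e}"
      then have "e \<in> L" by (auto simp: L_def)
      then obtain a x where "e = {x, a}" "a \<in> A" "x \<in> D" using LE by blast
      then show False using ij A_D_disjoint by blast
    qed
  qed (use fin in auto)
  also have "(\<Union>a\<in>A. {e \<in> F. a \<in> e}) = L" by (auto simp: L_def)
  finally have fA: "sum f A = card L" .
  \<comment> \<open>An edge of \<open>L\<close> meets \<open>D\<close> in a single vertex;
    \<open>g\<close> gives the component of that vertex.\<close>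
  define g where "g e = adjD\<^sup>* `` (e \<inter> D)" for e
  have g: "g {x, a} = component x" if "a \<in> A" "x \<in> D" for a x
    using that A_D_disjoint by (auto simp: g_def component_def)
  have inj_g: "inj_on g L"
  proof (rule inj_onI)
    fix e1 e2 assume e: "e1 \<in> L" "e2 \<in> L" "g e1 = g e2"
    obtain a1 x1 where 1: "e1 = {x1, a1}" "a1 \<in> A" "x1 \<in> D" using LE[OF e(1)] by blast
    obtain a2 x2 where 2: "e2 = {x2, a2}" "a2 \<in> A" "x2 \<in> D" using LE[OF e(2)] by blast
    have "component x1 = component x2" using e(3) g 1 2 by simp
    then have "(x1, x2) \<in> adjD\<^sup>*" by (auto simp: component_def)
    moreover have "{x1, a1} \<in> F" "{x2, a2} \<in> F" using e 1 2 by (auto simp: L_def)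
    moreover have "a1 \<notin> D" "a2 \<notin> D" using 1 2 A_D_disjoint by auto
    ultimately show "e1 = e2" using component_one_exit[OF F] 1 2 by simp
  qed
  have inj_c: "inj_on component (bad F)"
  proof (rule inj_onI)
    fix x y assume xy: "x \<in> bad F" "y \<in> bad F" "component x = component y"
    then have "(x, y) \<in> adjD\<^sup>*" by (auto simp: component_def)
    then show "x = y" using component_one_token[OF _ F] xy by blast
  qed
  have disj: "g ` L \<inter> component ` bad F = {}"
  proof (rule equals0I)
    fix K assume "K \<in> g ` L \<inter> component ` bad F"
    then obtain e u where eu: "e \<in> L" "u \<in> bad F" "g e = component u" by auto
    obtain a x where ax: "e = {x, a}" "a \<in> A" "x \<in> D" using LE[OF eu(1)] by blast
    have "component x = component u" using eu(3) g ax by simp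
    then have "(u, x) \<in> adjD\<^sup>*" by (auto simp: component_def)
    moreover have "{x, a} \<in> F" "a \<notin> D" using eu ax A_D_disjoint by (auto simp: L_def)
    ultimately show False using token_component_no_exit[OF _ F eu(2)] by blast
  qed
  have fl: "finite L" using fin by (simp add: L_def)
  have "sum f A + card (bad F) = card (g ` L) + card (component ` bad F)"
    using fA card_image[OF inj_g] card_image[OF inj_c] by simp
  also have "\<dots> = card (g ` L \<union> component ` bad F)"
    using disj fl by (simp add: card_Un_disjoint)
  also have "\<dots> \<le> card (component ` D)"
  proof (rule card_mono)
    have "g e \<in> component ` D" if "e \<in> L" for e
      using LE[OF that] g by blast
    moreover have "component u \<in> component ` D" if "u \<in> bad F" for u using D_I[OF F that] by blast
    ultimately show "g ` L \<union> component ` bad F \<subseteq> component ` D" by blast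
  qed (use fin in simp)
  finally show ?thesis .
qed

text \<open>In an optimal \<open>F\<close> with as many edges as possible, a bad vertex has an unused edge by the degree
  bound; as its other end lies in \<open>D\<close>, adding it moves the token without raising the deficiency.\<close>
lemma no_separator_imp_factor:
  assumes degE: "\<And>v. v \<in> V \<Longrightarrow> f v \<le> Suc (deg E v)" and A: "A = {}"
  shows "\<exists>F. optimal F \<and> bad F = {}"
proof -
  have "card F < Suc (card E)" if "optimal F" for F
    using optimal_feasible[OF that] card_mono[OF finite_E] by (auto simp: feasible_def le_imp_less_Suc)
  then obtain F where F: "optimal F" and max: "\<And>F'. optimal F' \<Longrightarrow> card F' \<le> card F"
    using optimal_exists ex_has_greatest_nat[of optimal _ card "Suc (card E)"] by (metis less_imp_le)
  have fs: "feasible F" by (rule optimal_feasible[OF F])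
  have fin: "finite F" by (rule feasible_finite[OF fs])
  have "v \<notin> bad F" for v
  proof
    assume v: "v \<in> bad F"
    have vV: "v \<in> V" using v by (simp add: bad_def)
    \<comment> \<open>The even degree of \<open>v\<close> is below the even \<open>f v\<close>,
      hence at most \<open>f v - 2\<close>, while \<open>deg E v\<close> is at least
      \<open>f v - 1\<close>.\<close>
    have "deg F v \<noteq> deg E v"
    proof
      assume "deg F v = deg E v"
      then have "Suc (deg F v) = f v" using degE[OF vV] v by (simp add: bad_def)
      then show False using v even_f[OF vV] by (auto simp: bad_def) (metis even_Suc)
    qed
    moreover have "deg F v \<le> deg E v"
      unfolding deg_def using fs finite_E by (intro card_mono) (auto simp: feasible_def)
    ultimately have "deg F v < deg E v" by simp
    then obtain e where e: "e \<in> E" "e \<notin> F" "v \<in> e"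
      by (rule deg_less_obtain_edge[OF fin finite_E])
    obtain x where x: "e = {v, x}" using doubleton_other[OF edge_card[OF e(1)] e(3)] by metis
    have eE: "{v, x} \<in> E" using e x by simp
    have xD: "x \<in> D" using D_neighbour[OF D_I[OF F v] eE] A by blast
    have h: "x \<notin> full F \<or> {v, x} \<in> F" using D_not_full[OF F xD] by blast
    note t = toggle_token[OF fs v eE h]
    have xb: "x \<notin> bad F" using toggle_two_tokens[OF fs v _ eE] optimal_le[OF F] by fastforce
    have "card (bad (toggle {v, x} F)) \<le> card (bad F)"
    proof (cases "x \<in> bad (toggle {v, x} F)")
      case True
      show ?thesis unfolding t(3)[OF True] using card_swap[OF finite_bad v xb] by simp
    next
      case False
      show ?thesis unfolding t(4)[OF False] by (intro card_mono) auto
    qed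
    then have "optimal (toggle {v, x} F)" by (rule optimalI[OF F t(2)])
    from max[OF this] show False using e x fin by (simp add: toggle_def)
  qed
  then show ?thesis using F by blast
qed

end

section \<open>Passing between symmetric digraphs and sets of two-element edges\<close>

context graph
begin

definition edges :: "'a set set" where
  "edges = (\<lambda>e. {tail G e, head G e}) ` arcs G"

definition edge_subgraph :: "'a set set \<Rightarrow> ('a, 'b) pre_digraph" where
  "edge_subgraph F = G\<lparr>arcs := {e \<in> arcs G. {tail G e, head G e} \<in> F}\<rparr>"

lemma edges_iff_dominates: "{u, v} \<in> edges \<longleftrightarrow> u \<rightarrow>\<^bsub>G\<^esub> v"
proof
  assume "{u, v} \<in> edges"
  then have "u \<rightarrow>\<^bsub>G\<^esub> v \<or> v \<rightarrow>\<^bsub>G\<^esub> u"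
    by (auto simp: edges_def arcs_ends_conv doubleton_eq_iff)
  then show "u \<rightarrow>\<^bsub>G\<^esub> v" using arcs_ends_symmetric[OF sym_arcs] by blast
qed (auto simp: edges_def arcs_ends_conv)

text \<open>Forgetting orientation matches the arcs leaving \<open>v\<close> with the edges at
  \<open>v\<close>: injectively because there are no parallel arcs, surjectively because every edge
  has an arc in each direction.\<close>

lemma vdegree_edge_subgraph:
  assumes "F \<subseteq> edges"
  shows "vdegree (edge_subgraph F) v = deg F v"
proof -
  have "bij_betw (\<lambda>e. {tail G e, head G e}) (out_arcs (edge_subgraph F) v) {e \<in> F. v \<in> e}"
    unfolding bij_betw_def
  proof (intro conjI)
    show "inj_on (\<lambda>e. {tail G e, head G e}) (out_arcs (edge_subgraph F) v)"
    proof (rule inj_onI)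
      fix a b assume ab: "a \<in> out_arcs (edge_subgraph F) v" "b \<in> out_arcs (edge_subgraph F) v"
        "{tail G a, head G a} = {tail G b, head G b}"
      then have "arc_to_ends G a = arc_to_ends G b"
        by (auto simp: out_arcs_def edge_subgraph_def arc_to_ends_def doubleton_eq_iff)
      then show "a = b" using ab no_multi_arcs by (auto simp: out_arcs_def edge_subgraph_def)
    qed
    show "(\<lambda>e. {tail G e, head G e}) ` out_arcs (edge_subgraph F) v = {e \<in> F. v \<in> e}"
    proof (intro equalityI subsetI)
      fix e assume "e \<in> {e \<in> F. v \<in> e}"
      then have e: "e \<in> F" "v \<in> e" by auto
      then obtain u where u: "e = {v, u}" using assms by (auto simp: edges_def)
      then have "v \<rightarrow>\<^bsub>G\<^esub> u" using e assms edges_iff_dominates by blast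
      then obtain a where "a \<in> arcs G" "tail G a = v" "head G a = u" by blast
      then show "e \<in> (\<lambda>e. {tail G e, head G e}) ` out_arcs (edge_subgraph F) v"
        using u e by (intro image_eqI[of _ _ a]) (auto simp: out_arcs_def edge_subgraph_def)
    qed (auto simp: out_arcs_def edge_subgraph_def)
  qed
  then show ?thesis by (simp add: vdegree_def out_degree_def deg_def bij_betw_same_card)
qed

lemma graph_edge_subgraph: "graph (edge_subgraph F)" and spanning_edge_subgraph: "spanning (edge_subgraph F) G"
proof -
  interpret H: wf_digraph "edge_subgraph F"
    by unfold_locales (auto simp: edge_subgraph_def)
  have "symmetric (edge_subgraph F)"
    unfolding symmetric_conv
  proof
    fix e assume "e \<in> arcs (edge_subgraph F)"
    then have e: "e \<in> arcs G" "{tail G e, head G e} \<in> F" by (auto simp: edge_subgraph_def)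
    then obtain e' where "e' \<in> arcs G" "tail G e = head G e'" "head G e = tail G e'"
      using sym_arcs unfolding symmetric_conv by blast
    then show "\<exists>e2\<in>arcs (edge_subgraph F). tail (edge_subgraph F) e = head (edge_subgraph F) e2 \<and>
        head (edge_subgraph F) e = tail (edge_subgraph F) e2"
      using e by (intro bexI[of _ e']) (auto simp: edge_subgraph_def insert_commute)
  qed
  then show "graph (edge_subgraph F)"
    by unfold_locales
      (auto simp: edge_subgraph_def no_loops arc_to_ends_def intro: no_multi_arcs)
  show "spanning (edge_subgraph F) G"
    using H.wf_digraph wf_digraph
    by (auto simp: spanning_def subgraph_def compatible_def edge_subgraph_def)
qed

lemma even_capacity_graphI:
  assumes "\<And>v. v \<in> verts G \<Longrightarrow> even (g v)"
  shows "even_capacity_graph (verts G) edges g"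
proof
  fix e assume "e \<in> edges"
  then show "e \<subseteq> verts G" "card e = 2"
    using no_loops by (auto simp: edges_def card_2_iff)
qed (use assms in auto)

text \<open>All neighbours of \<open>D\<close> outside \<open>D\<close> lie in \<open>A\<close>, so
  after deleting \<open>A\<close> each component of \<open>D\<close> is a whole component of the
  graph, of odd order by \<open>odd_component\<close>.\<close>

lemma components_le_num_odd_components:
  assumes "even_capacity_graph (verts G) edges g"
  shows "card (even_capacity_graph.component (verts G) edges g ` even_capacity_graph.D (verts G) edges g)
    \<le> num_odd_components (delete_verts G (even_capacity_graph.A (verts G) edges g))"
proof -
  interpret C: even_capacity_graph "verts G" edges g by (rule assms(1))
  let ?H = "delete_verts G C.A"
  have ind: "induced_subgraph ?H G"
    unfolding delete_verts_def by (rule induced_induce) auto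
  interpret H: wf_digraph ?H by (rule wf_digraphI_induced[OF ind])
  have symH: "symmetric ?H" by (rule induced_graph_imp_symmetric[OF sym_arcs ind])
  have verts: "verts ?H = verts G - C.A" by (simp add: delete_verts_def)
  have finH: "finite (verts ?H)" by (simp add: verts)
  have dom: "x \<rightarrow>\<^bsub>?H\<^esub> y \<longleftrightarrow> {x, y} \<in> edges \<and> x \<notin> C.A \<and> y \<notin> C.A" for x y
    unfolding edges_iff_dominates using wellformed
    by (auto simp: arcs_ends_conv delete_verts_def)
  have DH: "C.D \<subseteq> verts ?H" unfolding verts using C.D_V C.A_D_disjoint by auto
  have cl: "(x, y) \<in> C.adjD" if "x \<in> C.D" "x \<rightarrow>\<^bsub>?H\<^esub> y" for x y
    using that C.D_neighbour by (auto simp: dom C.adjD_def)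
  have reach: "x \<rightarrow>\<^sup>*\<^bsub>?H\<^esub> y \<longleftrightarrow> (x, y) \<in> C.adjD\<^sup>*" if x: "x \<in> C.D" for x y
  proof
    assume "x \<rightarrow>\<^sup>*\<^bsub>?H\<^esub> y"
    then show "(x, y) \<in> C.adjD\<^sup>*"
    proof (induction rule: H.reachable_induct)
      case (step y z)
      have "y \<in> C.D" using C.adjD_in_D[OF step.IH] x by simp
      then show ?case using cl step by (meson rtrancl.rtrancl_into_rtrancl)
    qed simp
  next
    assume "(x, y) \<in> C.adjD\<^sup>*"
    then show "x \<rightarrow>\<^sup>*\<^bsub>?H\<^esub> y"
    proof (induction rule: rtrancl_induct)
      case base
      then show ?case using x DH by auto
    next
      case (step y z)
      have "y \<rightarrow>\<^bsub>?H\<^esub> z"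
        using step.hyps(2) C.A_D_disjoint by (auto simp: dom C.adjD_def)
      then show ?case using step.IH by (rule H.reachable_adj_trans[rotated])
    qed
  qed
  \<comment> \<open>By symmetry mutual reachability is plain reachability.\<close>
  have scc: "H.scc_of x = C.component x" if "x \<in> C.D" for x
    using reach[OF that] symmetric_reachable[OF symH]
    by (auto simp: H.scc_of_def C.component_def)
  have "?H \<restriction> C.component x \<in> odd_components ?H" if "x \<in> C.D" for x
  proof -
    have "C.component x \<in> H.sccs_verts" using H.scc_of_in_sccs_verts scc[OF that] DH that by force
    then show ?thesis
      using H.in_sccs_verts_conv C.odd_component that by (auto simp: odd_components_def)
  qed
  then have sub: "(\<lambda>K. ?H \<restriction> K) ` C.component ` C.D \<subseteq> odd_components ?H" by blast
  have "inj_on (\<lambda>K. ?H \<restriction> K) (C.component ` C.D)"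
    by (rule inj_onI) (metis induce_subgraph_verts)
  then have "card (C.component ` C.D) = card ((\<lambda>K. ?H \<restriction> K) ` C.component ` C.D)" by (simp add: card_image)
  also have "\<dots> \<le> card (odd_components ?H)"
  proof (rule card_mono[OF _ sub])
    have "finite H.sccs_verts"
      by (rule finite_subset[of _ "Pow (verts ?H)"]) (use H.sccs_verts_subsets finH in auto)
    then show "finite (odd_components ?H)"
      by (auto simp: odd_components_def H.sccs_conv_sccs_verts)
  qed
  finally show ?thesis by (simp add: num_odd_components_def)
qed

end

section \<open>Existence of the factor\<close>

theorem theorem6:
  fixes G :: "('a,'b) pre_digraph" and f :: "'a \<Rightarrow> int"
  assumes "graph G"
    and "Digraph_Component.connected G"
    and "odd (card (verts G))"
    and "\<forall>v\<in>verts G. f v > 0"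
    and "\<forall>v\<in>verts G. even (f v)"
    and "\<forall>v\<in>verts G. f v \<ge> 4"
    and "\<forall>v\<in>verts G. int (vdegree G v) \<ge> f v - 1"
    and "\<forall>S. S \<noteq> {} \<and> S \<subseteq> verts G \<longrightarrow>
           int (num_odd_components (delete_verts G S)) \<le> (\<Sum>x\<in>S. f x)"
  shows "\<exists>F. H_factor G (H_f f) F"
proof -
  interpret graph G by (rule assms(1))
  \<comment> \<open>Positivity of \<open>f\<close> on the vertices makes the passage to naturals
    faithful.\<close>
  define g where "g v = nat (f v)" for v
  have fg: "int (g v) = f v" if "v \<in> verts G" for v using assms(4) that by (simp add: g_def less_imp_le)
  have ecg: "even_capacity_graph (verts G) edges g"
    by (rule even_capacity_graphI) (use assms(5) fg in \<open>metis even_of_nat\<close>)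
  interpret C: even_capacity_graph "verts G" edges g by (rule ecg)
  have "edge_subgraph edges = G" by (intro pre_digraph.equality) (auto simp: edge_subgraph_def edges_def)
  then have deg: "vdegree G v = deg edges v" for v
    using vdegree_edge_subgraph[of edges v] by simp
  have "\<exists>F. C.optimal F \<and> C.bad F = {}"
  proof (cases "C.A = {}")
    case True
    show ?thesis
    proof (rule C.no_separator_imp_factor[OF _ True])
      fix v assume "v \<in> verts G"
      then show "g v \<le> Suc (deg edges v)" using assms(7) fg deg by force
    qed
  next
    case False
    obtain F where F: "C.optimal F" using C.optimal_exists by blast
    have "int (num_odd_components (delete_verts G C.A)) \<le> (\<Sum>x\<in>C.A. f x)"
      using assms(8) False C.A_subset by blast
    also have "\<dots> = (\<Sum>x\<in>C.A. int (g x))"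
      using fg C.A_subset by (intro sum.cong) auto
    finally have "num_odd_components (delete_verts G C.A) \<le> sum g C.A"
      by (simp flip: of_nat_sum)
    \<comment> \<open>\<open>f(A)\<close> plus the number of bad vertices is at most the number of
      components of \<open>D\<close>, hence at most the number of odd components of
      \<open>G - A\<close>, which is at most \<open>f(A)\<close>.\<close>
    then have "card (C.bad F) = 0"
      using components_le_num_odd_components[OF ecg] C.comps_exceed[OF F] by linarith
    then show ?thesis using F by auto
  qed
  then obtain F where F: "C.feasible F" "C.bad F = {}" using C.optimal_feasible by blast
  have "int (vdegree (edge_subgraph F) v) \<in> H_f f v" if v: "v \<in> verts G" for v
  proof -
    have d: "vdegree (edge_subgraph F) v = deg F v"
      using F by (intro vdegree_edge_subgraph) (simp add: C.feasible_def)
    show ?thesis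
    proof (cases "v \<in> C.full F")
      case True
      then show ?thesis using fg[OF v] d by (simp add: C.full_def H_f_def)
    next
      case False
      then have "odd (deg F v)" "deg F v < g v" using C.odd_degI[OF F(1) v] F(2) by auto
      then show ?thesis using fg[OF v] d by (auto simp: H_f_def elim: oddE)
    qed
  qed
  then have "H_factor G (H_f f) (edge_subgraph F)"
    using graph_edge_subgraph spanning_edge_subgraph by (simp add: H_factor_def)
  then show ?thesis by blast
qed

end
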